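(* If $k=p^e$ for a prime $p$ and an integer $e\ge1$, then $||1||_k=k$.
   Context: An expression is a formal term built from the symbol $x$ using the binary operations $+$ and $\cdot$ (with parentheses); its size is the number of occurrences of $x$ in it. For an integer $k\ge1$ let $\zeta_k=e^{2\pi i/k}$. For $\alpha\in\mathbb{Z}[\zeta_k]$, $||\alpha||_k$ is the minimum size of an expression which evaluates to $\alpha$ when $x=\zeta_k$. *)

theory Defs
  imports Complex_Main "HOL-Computational_Algebra.Primes"
begin

datatype expr = X | Add expr expr | Mul expr expr

primrec expr_size :: "expr \<Rightarrow> nat" where
  "expr_size X = 1"
| "expr_size (Add s t) = expr_size s + expr_size t"
| "expr_size (Mul s t) = expr_size s + expr_size t"

primrec expr_eval :: "'a::comm_ring_1 \<Rightarrow> expr \<Rightarrow> 'a" where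
  "expr_eval x X = x"
| "expr_eval x (Add s t) = expr_eval x s + expr_eval x t"
| "expr_eval x (Mul s t) = expr_eval x s * expr_eval x t"

definition zeta :: "nat \<Rightarrow> complex" where
  "zeta k = exp (2 * of_real pi * \<i> / of_nat k)"

(* The infimum of a nonempty set of naturals is its minimum. If no expression evaluates to
   \<alpha> (in particular if \<alpha> is not in Z[zeta k]), the value is Inf {} = 0, which is not
   the size of any expression. *)
definition complexity :: "nat \<Rightarrow> complex \<Rightarrow> nat" where
  "complexity k \<alpha> = Inf {expr_size t | t. expr_eval (zeta k) t = \<alpha>}"

end

theory Submission
  imports Defs "HOL-Computational_Algebra.Polynomial"
begin

text \<open>An expression is an integer polynomial \<open>P\<close> with nonnegative coefficients, zero constant term
  and degree at most the size of the expression. Suppose \<open>P\<close> has degree less than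
  \<open>k = p ^ e\<close> and takes the value \<open>1\<close> at \<open>\<zeta>\<^sub>k\<close>. The cyclotomic polynomial
  \<open>\<Phi> = (x\<^sup>k - 1) / (x\<^sup>m - 1)\<close>, \<open>m = k / p\<close>, is irreducible by Eisenstein's
  criterion, hence divides \<open>P - 1\<close>, and the quotient has degree less than \<open>m\<close>. Multiplying by
  \<open>x\<^sup>m - 1\<close> and comparing coefficients at \<open>x\<^sup>m\<close> shows that \<open>P - 1\<close> has the same coefficient
  at \<open>x\<^sup>m\<close> as at \<open>1\<close>, namely \<open>-1\<close>; but the former is nonnegative.
  Conversely \<open>x\<^sup>k\<close> evaluates to \<open>1\<close>.\<close>

section \<open>Evaluation of integer polynomials\<close>

definition ieval :: "complex \<Rightarrow> int poly \<Rightarrow> complex" where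
  "ieval z P = poly (map_poly of_int P) z"

lemma ieval_0 [simp]: "ieval z 0 = 0"
  by (simp add: ieval_def)

lemma ieval_pCons [simp]: "ieval z (pCons a P) = of_int a + z * ieval z P"
  by (simp add: ieval_def map_poly_pCons)

lemma ieval_1 [simp]: "ieval z 1 = 1"
  by (simp add: one_pCons)

lemma ieval_add [simp]: "ieval z (P + Q) = ieval z P + ieval z Q"
  by (induction P Q rule: poly_induct2) (simp_all add: algebra_simps)

lemma ieval_smult [simp]: "ieval z (smult c P) = of_int c * ieval z P"
  by (induction P) (simp_all add: algebra_simps)

lemma ieval_diff [simp]: "ieval z (P - Q) = ieval z P - ieval z Q"
  using ieval_add [of z "P - Q" Q] by simp

lemma ieval_mult [simp]: "ieval z (P * Q) = ieval z P * ieval z Q"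
  by (induction P) (simp_all add: algebra_simps)

lemma ieval_power [simp]: "ieval z (P ^ n) = ieval z P ^ n"
  by (induction n) simp_all

text \<open>Divisibility holds over the integers, not just over the rationals, because \<open>G\<close> is chosen
  primitive, so that Gauss's lemma on contents applies.\<close>

lemma primitive_minimal_polynomial:
  assumes "P \<noteq> 0" "ieval z P = 0"
  obtains G where "G \<noteq> 0" "ieval z G = 0" "\<And>F. ieval z F = 0 \<Longrightarrow> G dvd F"
proof -
  define S where "S G \<longleftrightarrow> G \<noteq> 0 \<and> ieval z G = 0" for G
  define G0 where "G0 = arg_min degree S"
  have "S P"
    using assms by (simp add: S_def)
  then have G0: "S G0" and min: "\<And>F. S F \<Longrightarrow> degree G0 \<le> degree F"
    unfolding G0_def by (auto intro: arg_min_natI arg_min_nat_le)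
  define G where "G = primitive_part G0"
  have nz: "G0 \<noteq> 0" "content G0 \<noteq> 0"
    using G0 by (auto simp: S_def)
  have eq: "G0 = smult (content G0) G"
    by (simp add: G_def)
  have "ieval z G = 0"
    using G0 nz ieval_smult [of z "content G0" G] eq by (simp add: S_def)
  moreover have "G \<noteq> 0"
    using nz eq by auto
  moreover have "G dvd F" if F: "ieval z F = 0" for F
  proof -
    \<comment> \<open>The integers are not a field, so division with remainder by \<open>G\<close>
      first scales \<open>F\<close> by some nonzero \<open>a\<close>, which has to be cancelled
      afterwards.\<close>
    from pseudo_mod(1) [OF \<open>G \<noteq> 0\<close>, of F] obtain a Q
      where a: "a \<noteq> 0" and Q: "smult a F = G * Q + pseudo_mod F G" by blast
    have "ieval z (pseudo_mod F G) = 0"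
      using arg_cong [OF Q, of "ieval z"] F \<open>ieval z G = 0\<close> by simp
    moreover have "degree G = degree G0"
      by (simp add: G_def)
    ultimately have "pseudo_mod F G = 0"
      using pseudo_mod(2) [OF \<open>G \<noteq> 0\<close>, of F] min [of "pseudo_mod F G"] by (force simp: S_def)
    with Q have FQ: "smult a F = G * Q" by simp
    \<comment> \<open>\<open>G\<close> has content 1, so the content of \<open>Q\<close> is that of
      \<open>smult a F\<close>; hence \<open>a\<close> divides every coefficient of
      \<open>Q\<close>.\<close>
    have "content Q = content (G * Q)"
      using nz by (simp add: content_mult G_def)
    also have "\<dots> = normalize a * content F"
      by (simp flip: FQ)
    finally have "a dvd content Q" by simp
    then have "[:a:] dvd Q"
      by (simp add: const_poly_dvd_iff_dvd_content)
    then obtain Q' where "Q = smult a Q'"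
      by (auto elim: dvdE)
    with FQ have "smult a F = smult a (G * Q')" by simp
    then have "[:a:] * F = [:a:] * (G * Q')" by simp
    with a have "F = G * Q'" by (simp only: mult_cancel_left) simp
    then show ?thesis by simp
  qed
  ultimately show thesis
    using that by blast
qed

section \<open>Eisenstein's criterion at the point 1\<close>

lemma prime_dvd_freshmans_dream:
  fixes a b :: "'a :: comm_ring_1"
  assumes "prime p"
  shows "of_nat p dvd (a + b) ^ p - (a ^ p + b ^ p)"
proof -
  have p: "p > 0"
    using assms by (simp add: prime_gt_0_nat)
  let ?t = "\<lambda>i. of_nat (p choose i) * a ^ i * b ^ (p - i)"
  have "{..p} = insert 0 (insert p {0<..<p})" by auto
  then have "(a + b) ^ p = ?t 0 + (?t p + sum ?t {0<..<p})"
    unfolding binomial_ring using p by simp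
  then have "(a + b) ^ p - (a ^ p + b ^ p) = sum ?t {0<..<p}"
    by simp
  moreover have "of_nat p dvd sum ?t {0<..<p}"
  proof (intro dvd_sum dvd_mult2)
    fix i assume "i \<in> {0<..<p}"
    then have "p dvd p choose i"
      using assms by (intro dvd_choose_prime) auto
    then show "(of_nat p :: 'a) dvd of_nat (p choose i)"
      by (auto elim: dvdE)
  qed
  ultimately show ?thesis by simp
qed

text \<open>Since \<open>u - v\<close> divides \<open>u ^ p - v ^ p\<close>, a congruence modulo
  \<open>p\<close> survives raising to the power \<open>p\<close>, which allows induction on
  \<open>e\<close>.\<close>

lemma prime_dvd_freshmans_dream_power:
  fixes a b :: "'a :: comm_ring_1"
  assumes "prime p"
  shows "of_nat p dvd (a + b) ^ (p ^ e) - (a ^ (p ^ e) + b ^ (p ^ e))"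
proof (induction e)
  case (Suc e)
  let ?q = "p ^ e"
  have "(a + b) ^ ?q - (a ^ ?q + b ^ ?q) dvd ((a + b) ^ ?q) ^ p - (a ^ ?q + b ^ ?q) ^ p"
    unfolding power_diff_sumr2 by simp
  with Suc have "of_nat p dvd ((a + b) ^ ?q) ^ p - (a ^ ?q + b ^ ?q) ^ p"
    by (rule dvd_trans)
  moreover note prime_dvd_freshmans_dream [OF assms, of "a ^ ?q" "b ^ ?q"]
  ultimately have "of_nat p dvd (((a + b) ^ ?q) ^ p - (a ^ ?q + b ^ ?q) ^ p)
      + ((a ^ ?q + b ^ ?q) ^ p - ((a ^ ?q) ^ p + (b ^ ?q) ^ p))"
    by (rule dvd_add)
  then show ?case
    by (simp add: algebra_simps flip: power_mult)
qed simp

text \<open>Modulo \<open>q\<close>, the point 1 is a zero of order \<open>n\<close> of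
  \<open>A * B\<close> but not a zero of \<open>A\<close>, so \<open>B\<close> carries all
  \<open>n\<close> factors \<open>x - 1\<close>. Each induction step splits off one of them by
  synthetic division.\<close>

lemma degree_ge_if_cong_power:
  fixes A B :: "int poly"
  assumes "prime q" "[:q:] dvd A * B - [:-1, 1:] ^ n" "\<not> q dvd poly A 1" "\<not> [:q:] dvd B"
  shows "n \<le> degree B"
  using assms(2,4)
proof (induction n arbitrary: B)
  case (Suc n)
  have pr: "prime_elem [:q:]"
    using assms(1) by (intro lift_prime_elem_poly prime_imp_prime_elem)
  obtain K where K: "A * B - [:-1, 1:] ^ Suc n = [:q:] * K"
    using Suc.prems(1) by (elim dvdE)
  have "poly A 1 * poly B 1 = q * poly K 1"
    using arg_cong [OF K, of "\<lambda>P. poly P 1"] by simp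
  then have "q dvd poly A 1 * poly B 1" by simp
  then have q1: "q dvd poly B 1"
    using assms(1,3) by (simp add: prime_dvd_mult_iff)
  define B1 where "B1 = synthetic_div B 1"
  have B: "B = [:-1, 1:] * B1 + [:poly B 1:]"
    unfolding B1_def by (rule synthetic_div_correct' [symmetric])
  have q2: "[:q:] dvd [:poly B 1:]"
    using q1 by simp
  have "[:-1, 1:] * (A * B1 - [:-1, 1:] ^ n) = (A * B - [:-1, 1:] ^ Suc n) - A * [:poly B 1:]"
    using arg_cong [OF B, of "\<lambda>P. A * P"] by (simp only: algebra_simps power_Suc)
  also have "[:q:] dvd \<dots>"
    by (rule dvd_diff [OF Suc.prems(1) dvd_mult [OF q2]])
  finally have "[:q:] dvd [:-1, 1:] \<or> [:q:] dvd A * B1 - [:-1, 1:] ^ n"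
    by (rule prime_elem_dvd_multD [OF pr])
  moreover have "\<not> [:q:] dvd [:-1, 1:]"
  proof
    assume "[:q:] dvd [:-1, 1:]"
    then have "q dvd coeff [:-1, 1:] 1"
      unfolding const_poly_dvd_iff by (rule spec)
    then show False
      using assms(1) not_prime_unit [of q] by simp
  qed
  ultimately have "[:q:] dvd A * B1 - [:-1, 1:] ^ n"
    by blast
  moreover have q3: "\<not> [:q:] dvd B1"
  proof
    assume "[:q:] dvd B1"
    then have "[:q:] dvd [:-1, 1:] * B1 + [:poly B 1:]"
      using q2 by (intro dvd_add dvd_mult)
    then show False
      using Suc.prems(2) B by simp
  qed
  ultimately have "n \<le> degree B1"
    by (rule Suc.IH)
  \<comment> \<open>\<open>degree B1\<close> is the truncated difference
    \<open>degree B - 1\<close>. A constant \<open>B\<close> would give \<open>B1 = 0\<close>, which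
    is divisible by \<open>q\<close>.\<close>
  moreover have "degree B \<noteq> 0"
    using q3 synthetic_div_eq_0_iff [of B 1] by (auto simp: B1_def)
  ultimately show ?case
    by (simp add: B1_def degree_synthetic_div)
qed simp

text \<open>The factor \<open>M\<close> avoids reducing the cyclotomic polynomial itself modulo \<open>q\<close>: it is taken to be
  \<open>x\<^sup>m - 1\<close>, and then \<open>G * H * M = x\<^sup>k - 1\<close>.\<close>

lemma Eisenstein_at_1:
  fixes G H M :: "int poly"
  assumes "prime q" "poly (G * H) 1 = q" "lead_coeff (G * H * M) = 1"
    and "[:q:] dvd G * H * M - [:-1, 1:] ^ degree (G * H * M)"
  shows "degree G = 0 \<or> degree H = 0"
proof -
  have nd: "\<not> [:q:] dvd G * H * M"
  proof
    assume "[:q:] dvd G * H * M"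
    then have "q dvd lead_coeff (G * H * M)"
      by (simp add: const_poly_dvd_iff)
    then have "is_unit q"
      using assms(3) by (simp only:)
    then show False
      using assms(1) not_prime_unit by blast
  qed
  have nz: "G \<noteq> 0" "H \<noteq> 0" "M \<noteq> 0"
    using assms(3) by auto
  have deg: "degree (G * H * M) = degree G + degree H + degree M"
    using nz by (simp add: degree_mult_eq)
  \<comment> \<open>The product of the two values is \<open>q\<close>, which is not divisible by
    \<open>q * q\<close>.\<close>
  have "\<not> q dvd poly G 1 \<or> \<not> q dvd poly H 1"
  proof (rule ccontr)
    assume "\<not> ?thesis"
    then have "q * q dvd poly G 1 * poly H 1"
      by (auto intro: mult_dvd_mono)
    then have "q * q dvd q * 1"
      using assms(2) by simp
    then show False
      using assms(1) unfolding dvd_mult_cancel_left by auto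
  qed
  then show ?thesis
  proof
    assume "\<not> q dvd poly G 1"
    \<comment> \<open>The other factors carry the full power of \<open>x - 1\<close> modulo
      \<open>q\<close>, which leaves no degree for \<open>G\<close>.\<close>
    then have "degree (G * H * M) \<le> degree (H * M)"
      using assms(1,4) nd dvd_mult [of "[:q:]" "H * M" G]
      by (intro degree_ge_if_cong_power [of q G]) (auto simp: mult_ac)
    then show ?thesis
      using nz by (simp add: deg degree_mult_eq)
  next
    assume "\<not> q dvd poly H 1"
    then have "degree (G * H * M) \<le> degree (G * M)"
      using assms(1,4) nd dvd_mult [of "[:q:]" "G * M" H]
      by (intro degree_ge_if_cong_power [of q H]) (auto simp: mult_ac)
    then show ?thesis
      using nz by (simp add: deg degree_mult_eq)
  qed
qed

section \<open>Roots of unity of prime power order\<close>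

lemma zeta_power: "zeta k ^ n = cis (2 * pi * n / k)"
proof -
  have "zeta k = cis (2 * pi / k)"
    by (simp add: zeta_def cis_conv_exp mult_ac)
  then show ?thesis
    by (simp add: DeMoivre mult_ac)
qed

lemma zeta_power_self [simp]: "k > 0 \<Longrightarrow> zeta k ^ k = 1"
  by (simp add: zeta_power)

lemma zeta_power_neq_1:
  assumes "0 < n" "n < k"
  shows "zeta k ^ n \<noteq> 1"
proof
  assume "zeta k ^ n = 1"
  then have "cos (2 * pi * n / k) = 1"
    by (simp add: zeta_power cis.ctr complex_eq_iff)
  then obtain i :: int where "2 * pi * n / k = real_of_int i * 2 * pi"
    unfolding cos_one_2pi_int by blast
  then have "real n = of_int i * real k"
    using assms by (simp add: field_simps)
  then have "real_of_int (int n) = of_int (i * int k)"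
    by simp
  then have "int k dvd int n"
    unfolding of_int_eq_iff by simp
  then show False
    using assms by (simp add: nat_dvd_not_less)
qed

lemma degree_x_power_minus_1 [simp]:
  "degree ([:0, 1:] ^ n - 1 :: 'a :: comm_ring_1 poly) = n"
proof (cases "n = 0")
  case False
  then have "degree ([:0, 1:] ^ n + (- 1) :: 'a poly) = degree ([:0, 1:] ^ n :: 'a poly)"
    by (intro degree_add_eq_left) (simp add: degree_linear_power)
  then show ?thesis
    by (simp add: degree_linear_power)
qed simp

text \<open>Writing the order as \<open>p * p ^ e\<close> makes its exponent positive and
  \<open>p ^ e\<close> the number \<open>m\<close> of the overview.\<close>

lemma coeff_eq_if_ieval_zeta_eq_0:
  fixes F :: "int poly"
  assumes "prime p" and deg: "degree F < p * p ^ e" and root: "ieval (zeta (p * p ^ e)) F = 0"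
  shows "coeff F (p ^ e) = coeff F 0"
proof -
  define m k where "m = p ^ e" and "k = p * m"
  let ?x = "[:0, 1:] :: int poly"
  define Phi where "Phi = (\<Sum>i<p. (?x ^ m) ^ i)"
  have p: "p > 1" and m: "m > 0"
    using assms(1) by (simp_all add: m_def prime_gt_1_nat prime_gt_0_nat del: One_nat_def)
  then have mk: "m < k" and k: "k > 0"
    by (auto simp: k_def)
  have Phi: "Phi * (?x ^ m - 1) = ?x ^ k - 1"
    using power_diff_1_eq [of "?x ^ m" p]
    by (simp add: k_def Phi_def mult.commute flip: power_mult)
  have x_monom: "?x ^ n = monom 1 n" for n
    by (simp add: monom_altdef)
  have monic: "lead_coeff (?x ^ k - 1) = 1"
    unfolding degree_x_power_minus_1 using k by (simp add: x_monom)
  have "ieval (zeta k) Phi * (zeta k ^ m - 1) = 0"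
    using arg_cong [OF Phi, of "ieval (zeta k)"] k by simp
  then have "ieval (zeta k) Phi = 0"
    using zeta_power_neq_1 [OF m mk] by simp
  moreover have "Phi \<noteq> 0"
    using Phi monic by force
  ultimately obtain G where G: "G \<noteq> 0" "ieval (zeta k) G = 0"
    and G_dvd: "\<And>F. ieval (zeta k) F = 0 \<Longrightarrow> G dvd F"
    using primitive_minimal_polynomial by blast
  obtain H where H: "Phi = G * H"
    using G_dvd \<open>ieval (zeta k) Phi = 0\<close> by blast
  obtain Q where Q: "F = G * Q"
    using G_dvd root by (auto simp: k_def m_def)
  \<comment> \<open>Here \<open>x\<close> is split as \<open>(x - 1) + 1\<close>, so that
    \<open>x ^ k - 1\<close> is congruent to \<open>(x - 1) ^ k\<close> modulo
    \<open>p\<close>.\<close>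
  have "of_nat p dvd ?x ^ k - ([:-1, 1:] ^ k + 1)"
    using prime_dvd_freshmans_dream_power [OF assms(1), of "[:-1, 1:] :: int poly" 1 "Suc e"]
    by (simp add: k_def m_def flip: one_pCons) (simp add: one_pCons)
  then have "[:int p:] dvd G * H * (?x ^ m - 1) - [:-1, 1:] ^ degree (G * H * (?x ^ m - 1))"
    unfolding H [symmetric] Phi degree_x_power_minus_1
    by (simp add: of_nat_poly algebra_simps)
  moreover have "lead_coeff (G * H * (?x ^ m - 1)) = 1"
    unfolding H [symmetric] Phi by (rule monic)
  moreover have "poly (G * H) 1 = int p"
    by (simp add: Phi_def poly_sum flip: H)
  ultimately have "degree G = 0 \<or> degree H = 0"
    using assms(1) by (intro Eisenstein_at_1 [of "int p" G H "?x ^ m - 1"]) simp_all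
  \<comment> \<open>A nonzero constant does not vanish at \<open>zeta k\<close>, so it is
    \<open>H\<close> that is constant.\<close>
  moreover have "degree G \<noteq> 0"
  proof
    assume "degree G = 0"
    then obtain g where "G = [:g:]" by (rule degree_eq_zeroE)
    with G show False by simp
  qed
  ultimately obtain h where h: "H = [:h:]"
    by (auto elim: degree_eq_zeroE)
  have "h \<noteq> 0"
    using h H \<open>Phi \<noteq> 0\<close> by auto
  have eq: "smult h F * (?x ^ m - 1) = (?x ^ k - 1) * Q"
    by (simp add: Q h H mult_ac flip: Phi)
  have "degree Q < m"
  proof (cases "F = 0")
    case False
    have "?x ^ n - 1 \<noteq> 0" if "n > 0" for n
    proof
      assume "?x ^ n - 1 = 0"
      then show False
        using that degree_x_power_minus_1 [of n, where ?'a = int] by (simp only: degree_0)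
    qed
    then have "?x ^ m - 1 \<noteq> 0" "?x ^ k - 1 \<noteq> 0" "Q \<noteq> 0"
      using m k False Q by auto
    then have "degree F + m = k + degree Q"
      using arg_cong [OF eq, of degree] False \<open>h \<noteq> 0\<close> by (simp add: degree_mult_eq)
    then show ?thesis
      using deg by (simp add: k_def m_def)
  qed (use Q G(1) m in auto)
  \<comment> \<open>In \<open>x ^ k * Q - Q\<close> the first term starts beyond
    \<open>x ^ m\<close> and the second ends before it.\<close>
  then have "coeff (smult h F * (?x ^ m - 1)) m = 0"
    unfolding eq using mk by (simp add: x_monom left_diff_distrib coeff_monom_mult coeff_eq_0)
  then have "h * coeff F 0 = h * coeff F m"
    by (simp add: x_monom right_diff_distrib coeff_monom_mult mult.commute [of _ "monom _ _"])
  then show ?thesis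
    using \<open>h \<noteq> 0\<close> by (simp add: m_def)
qed

section \<open>Expressions\<close>

text \<open>The evaluation is polymorphic, so the polynomial of an expression is its value at the
  indeterminate.\<close>

definition expr_poly :: "expr \<Rightarrow> int poly" where
  "expr_poly = expr_eval [:0, 1:]"

lemma ieval_expr_poly [simp]: "ieval z (expr_poly t) = expr_eval z t"
  by (induction t) (simp_all add: expr_poly_def)

lemma degree_expr_poly: "degree (expr_poly t) \<le> expr_size t"
proof (induction t)
  case (Add s t)
  then show ?case
    using degree_add_le_max [of "expr_poly s" "expr_poly t"] by (simp add: expr_poly_def)
next
  case (Mul s t)
  then show ?case
    using degree_mult_le [of "expr_poly s" "expr_poly t"] by (simp add: expr_poly_def)
qed (simp add: expr_poly_def)

lemma coeff_expr_poly_nonneg: "coeff (expr_poly t) n \<ge> 0"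
  by (induction t arbitrary: n)
    (auto simp: expr_poly_def coeff_mult coeff_pCons split: nat.splits intro!: sum_nonneg)

lemma coeff_expr_poly_0 [simp]: "coeff (expr_poly t) 0 = 0"
  by (induction t) (simp_all add: expr_poly_def coeff_mult_0)

lemma expr_size_ge_if_eval_zeta_eq_1:
  assumes "prime p" "expr_eval (zeta (p * p ^ e)) t = 1"
  shows "p * p ^ e \<le> expr_size t"
proof (rule ccontr)
  assume "\<not> ?thesis"
  moreover have "degree (expr_poly t - 1) \<le> expr_size t"
    using degree_diff_le_max [of "expr_poly t" 1] degree_expr_poly [of t] by simp
  ultimately have "coeff (expr_poly t - 1) (p ^ e) = coeff (expr_poly t - 1) 0"
    using assms by (intro coeff_eq_if_ieval_zeta_eq_0) auto
  \<comment> \<open>The common coefficient is -1 at the constant term; at \<open>p ^ e > 0\<close>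
    subtracting 1 changes nothing, so there it is nonnegative.\<close>
  then show False
    using coeff_expr_poly_nonneg [of t "p ^ e"] assms(1) by (simp add: prime_gt_0_nat)
qed

lemma expr_power_exists:
  obtains t where "expr_size t = Suc n" "expr_eval x t = x ^ Suc n"
proof -
  have "\<exists>t. expr_size t = Suc n \<and> expr_eval x t = x ^ Suc n"
  proof (induction n)
    case 0
    show ?case by (intro exI [of _ X]) simp
  next
    case (Suc n)
    then obtain t where "expr_size t = Suc n" "expr_eval x t = x ^ Suc n" by blast
    then show ?case by (intro exI [of _ "Mul X t"]) simp
  qed
  then show thesis
    using that by blast
qed

theorem theorem2p11:
  fixes p e k :: nat
  assumes "prime p" and "e \<ge> 1" and "k = p ^ e"
  shows "complexity k 1 = k"
proof -
  obtain e' where e': "e = Suc e'"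
    using assms(2) by (cases e) auto
  have k: "k > 0"
    using assms by (simp add: prime_gt_0_nat)
  obtain t where "expr_size t = k" "expr_eval (zeta k) t = 1"
    using expr_power_exists [of "k - 1" "zeta k"] k by auto
  then have "k \<in> {expr_size t | t. expr_eval (zeta k) t = 1}"
    by blast
  moreover have "k \<le> n" if "n \<in> {expr_size t | t. expr_eval (zeta k) t = 1}" for n
    using that expr_size_ge_if_eval_zeta_eq_1 [OF assms(1), of e'] assms(3) e' by auto
  ultimately show ?thesis
    unfolding complexity_def by (intro cInf_eq_minimum)
qed

end
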